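(* Let $n$ and $w$ be integers with $1\le w\le n/2$. Then $$f(n,w)\le 2\,w^{1/2}\binom{n}{w}.$$
   Context: Write $[n]=\{1,\dots,n\}$. A (binary) code of length $n$ is a set $C\subset\{0,1\}^n$. For $W\subset[n]$, let $\pi_W:\{0,1\}^n\to\{0,1\}^W$, $x\mapsto (x_i)_{i\in W}$. For $c\in C$, a set $W\subset[n]$ is a witness set (witness) for $c$ in $C$ if $\pi_W(c)\neq\pi_W(c')$ for every $c'\in C$ with $c'\neq c$. A code $C$ has the $w$-witness property (is a $w$-witness code) if each of its codewords has a witness set of size $w$. For $w\le n$, $f(n,w)$ denotes the maximum cardinality of a $w$-witness code of length $n$. *)

theory Defs
  imports Complex_Main "HOL-Library.FuncSet"
begin

text \<open>
  A word of length \<open>n\<close> is an extensional function on \<open>{1..n}\<close>, so distinct words differ at some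
  coordinate in \<open>{1..n}\<close>, and cardinalities of codes are those of subsets of a \<open>2 ^ n\<close>-element set.
\<close>

definition words :: "nat \<Rightarrow> (nat \<Rightarrow> nat) set" where
  "words n = ({1..n} \<rightarrow>\<^sub>E {0, 1})"

definition proj :: "nat set \<Rightarrow> (nat \<Rightarrow> nat) \<Rightarrow> (nat \<Rightarrow> nat)" where
  "proj W x = restrict x W"

definition is_witness :: "nat \<Rightarrow> (nat \<Rightarrow> nat) set \<Rightarrow> (nat \<Rightarrow> nat) \<Rightarrow> nat set \<Rightarrow> bool" where
  "is_witness n C c W \<longleftrightarrow>
     W \<subseteq> {1..n} \<and> (\<forall>c'\<in>C. c' \<noteq> c \<longrightarrow> proj W c \<noteq> proj W c')"

definition witness_code :: "nat \<Rightarrow> nat \<Rightarrow> (nat \<Rightarrow> nat) set \<Rightarrow> bool" where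
  "witness_code n w C \<longleftrightarrow>
     C \<subseteq> words n \<and> (\<forall>c\<in>C. \<exists>W. is_witness n C c W \<and> card W = w)"

definition max_witness_code :: "nat \<Rightarrow> nat \<Rightarrow> nat" where
  "max_witness_code n w = Max (card ` {C. witness_code n w C})"

text \<open>
  The maximum ranges over a finite nonempty set of codes, so it is attained.
\<close>

lemma finite_words: "finite (words n)"
  unfolding words_def by (intro finite_PiE) auto

lemma finite_witness_codes: "finite {C. witness_code n w C}"
  by (rule finite_subset[of _ "Pow (words n)"]) (auto simp: witness_code_def finite_words)

lemma witness_code_empty: "witness_code n w {}"
  by (simp add: witness_code_def)

lemma max_witness_code_attained:
  "\<exists>C. witness_code n w C \<and> card C = max_witness_code n w"
proof -
  have "Max (card ` {C. witness_code n w C}) \<in> card ` {C. witness_code n w C}"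
    using finite_witness_codes witness_code_empty[of n w] by (intro Max_in) blast+
  then show ?thesis
    unfolding max_witness_code_def by auto
qed

lemma card_le_max_witness_code:
  "witness_code n w C \<Longrightarrow> card C \<le> max_witness_code n w"
  unfolding max_witness_code_def using finite_witness_codes by (intro Max_ge) auto

end

theory Submission
  imports Defs
begin

text \<open>
  Fix a code \<open>C\<close>, choose a witness \<open>W c\<close> of size \<open>w\<close> for every codeword \<open>c\<close>, and look at the
  code through a window \<open>T\<close> of \<open>m\<close> coordinates. Codewords whose witness lies inside \<open>T\<close> are pairwise
  distinguished by their coordinates in \<open>T\<close>, so there are at most \<open>2 ^ m\<close> of them. A given witness
  lies in \<open>(n - w) choose (m - w)\<close> of the \<open>n choose m\<close> windows, so counting the pairs of a codeword
  and a window containing its witness gives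
  \<open>card C * ((n - w) choose (m - w)) \<le> 2 ^ m * (n choose m)\<close>, that is,
  \<open>card C * (m choose w) \<le> 2 ^ m * (n choose w)\<close>.

  The ratio \<open>2 ^ m / (m choose w)\<close> is smallest for \<open>m\<close> near \<open>2 * w\<close>; the hypothesis
  \<open>2 * w \<le> n\<close> says exactly that a window of this size exists. With \<open>m = 2 * w\<close> the ratio is
  \<open>4 ^ w\<close> over a central binomial coefficient, and the classical estimate
  \<open>4 ^ w / ((2 * w) choose w) \<le> 2 * sqrt w\<close> finishes the proof.
\<close>

text \<open>
  The stated form is what makes the induction work: the successive quotients of
  \<open>k * ((2 * k) choose k)\<^sup>2\<close> are \<open>4 * (2 * k + 1)\<^sup>2 / (k * (k + 1))\<close>, which exceed \<open>16\<close>
  because \<open>(2 * k + 1)\<^sup>2 > 4 * k * (k + 1)\<close>.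
\<close>

lemma power_16_le_central_binomial_square:
  assumes "1 \<le> k"
  shows "16 ^ k \<le> 4 * k * ((2 * k) choose k)\<^sup>2"
  using assms
proof (induction k rule: dec_induct)
  case base
  then show ?case
    by (simp add: numeral_2_eq_2)
next
  case (step k)
  define b where "b = (2 * k) choose k"
  define b' where "b' = (2 * Suc k) choose Suc k"
  have "Suc k * b' = 2 * Suc k * (Suc (2 * k) choose k)"
    unfolding b'_def using Suc_times_binomial[of k "Suc (2 * k)"] by (simp del: binomial_Suc_Suc)
  also have "\<dots> = 2 * (Suc k * (Suc (2 * k) choose Suc k))"
    using binomial_symmetric[of k "Suc (2 * k)"] by (simp add: Suc_diff_le del: binomial_Suc_Suc)
  also have "\<dots> = 2 * (2 * k + 1) * b"
    unfolding b_def Suc_times_binomial by simp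
  finally have rec: "Suc k * b' = 2 * (2 * k + 1) * b" .
  have "Suc k * 16 ^ Suc k = 16 * Suc k * 16 ^ k"
    by (simp add: algebra_simps)
  also have "\<dots> \<le> 16 * Suc k * (4 * k * b\<^sup>2)"
    using step.IH unfolding b_def by (intro mult_left_mono) auto
  also have "\<dots> \<le> 16 * (2 * k + 1)\<^sup>2 * b\<^sup>2"
    by (simp add: power2_eq_square algebra_simps)
  also have "\<dots> = 4 * (2 * (2 * k + 1) * b)\<^sup>2"
    by (simp add: power2_eq_square algebra_simps)
  also have "\<dots> = Suc k * (4 * Suc k * b'\<^sup>2)"
    unfolding rec[symmetric] by (simp only: power2_eq_square mult_ac)
  finally show ?case
    unfolding b'_def by (simp only: Suc_mult_le_cancel1)
qed

lemma power_4_le_central_binomial: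
  assumes "1 \<le> k"
  shows "4 ^ k \<le> 2 * sqrt (real k) * real ((2 * k) choose k)"
proof (rule power2_le_imp_le)
  have "(4 ^ k)\<^sup>2 = (16 :: real) ^ k"
    by (simp add: power2_eq_square flip: power_mult_distrib)
  also have "\<dots> = real (16 ^ k)"
    by simp
  also have "\<dots> \<le> real (4 * k * ((2 * k) choose k)\<^sup>2)"
    using power_16_le_central_binomial_square[OF assms] by (subst of_nat_le_iff)
  also have "\<dots> = (2 * sqrt (real k) * real ((2 * k) choose k))\<^sup>2"
    by (simp add: power_mult_distrib)
  finally show "(4 ^ k)\<^sup>2 \<le> (2 * sqrt (real k) * real ((2 * k) choose k))\<^sup>2" .
qed simp

lemma card_supersets_within:
  assumes "finite S" and "W \<subseteq> S" and "card W \<le> m"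
  shows "card {T. T \<subseteq> S \<and> card T = m \<and> W \<subseteq> T} = (card S - card W) choose (m - card W)"
proof -
  have fin: "finite W"
    using assms finite_subset by blast
  have card_diff: "card (T - W) = m - card W"
    if "card T = m" "W \<subseteq> T" for T
    using that fin by (simp add: card_Diff_subset)
  have card_union: "card (U \<union> W) = m"
    if "U \<subseteq> S - W" "card U = m - card W" for U
    using that assms fin
    by (subst card_Un_disjoint) (auto intro: finite_subset)
  have "bij_betw (\<lambda>T. T - W) {T. T \<subseteq> S \<and> card T = m \<and> W \<subseteq> T}
          {U. U \<subseteq> S - W \<and> card U = m - card W}"
    by (rule bij_betw_byWitness[where f' = "\<lambda>U. U \<union> W"])
      (use card_diff card_union assms(2) in auto)
  then have "card {T. T \<subseteq> S \<and> card T = m \<and> W \<subseteq> T} = card {U. U \<subseteq> S - W \<and> card U = m - card W}"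
    by (rule bij_betw_same_card)
  also have "\<dots> = (card S - card W) choose (m - card W)"
    using assms fin by (simp add: n_subsets card_Diff_subset)
  finally show ?thesis .
qed

lemma is_witness_mono:
  assumes "is_witness n C c W" and "W \<subseteq> T" and "T \<subseteq> {1..n}"
  shows "is_witness n C c T"
proof -
  have "proj W c = proj W c'" if "proj T c = proj T c'" for c'
  proof -
    have "proj W x = restrict (proj T x) W" for x
      using assms(2) by (simp add: proj_def Int_absorb1)
    with that show ?thesis
      by simp
  qed
  then show ?thesis
    using assms unfolding is_witness_def by blast
qed

text \<open>
  A common witness \<open>T\<close> makes the projection to \<open>T\<close> injective, and there are only
  \<open>2 ^ card T\<close> binary patterns on \<open>T\<close>.
\<close>

lemma card_common_witness_le:
  assumes "C \<subseteq> words n" and "T \<subseteq> {1..n}"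
  shows "card {c \<in> C. is_witness n C c T} \<le> 2 ^ card T"
proof -
  have fin: "finite T"
    using assms(2) finite_subset by blast
  have "inj_on (proj T) {c \<in> C. is_witness n C c T}"
  proof (rule inj_onI)
    fix c c'
    assume "c \<in> {c \<in> C. is_witness n C c T}" and "c' \<in> {c \<in> C. is_witness n C c T}"
      and "proj T c = proj T c'"
    then show "c = c'"
      unfolding is_witness_def by (metis (mono_tags, lifting) mem_Collect_eq)
  qed
  moreover have "proj T ` {c \<in> C. is_witness n C c T} \<subseteq> (T \<rightarrow>\<^sub>E {0, 1})"
    using assms unfolding words_def proj_def
    by (intro image_subsetI) (simp only: restrict_PiE_iff, blast dest: PiE_mem)
  moreover have "finite (T \<rightarrow>\<^sub>E {0, 1 :: nat})"
    using fin by (intro finite_PiE) auto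
  ultimately have "card {c \<in> C. is_witness n C c T} \<le> card (T \<rightarrow>\<^sub>E {0, 1 :: nat})"
    by (rule card_inj_on_le)
  also have "\<dots> = 2 ^ card T"
    using fin by (simp add: card_PiE numeral_2_eq_2)
  finally show ?thesis .
qed

text \<open>
  Averaging over all windows \<open>T\<close> of \<open>m\<close> coordinates, by counting the pairs of a codeword and a
  window containing its chosen witness.
\<close>

lemma witness_code_window_bound:
  assumes code: "witness_code n w C" and "w \<le> m" and "m \<le> n"
  shows "card C * (m choose w) \<le> 2 ^ m * (n choose w)"
proof -
  from code obtain W where W: "is_witness n C c (W c)" "card (W c) = w" if "c \<in> C" for c
    unfolding witness_code_def by metis
  have sub: "C \<subseteq> words n"
    using code by (simp add: witness_code_def)
  then have fin: "finite C"
    using finite_words finite_subset by blast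
  define windows where "windows = {T. T \<subseteq> {1..n} \<and> card T = m}"
  have fin_windows: "finite windows"
    unfolding windows_def by simp
  have card_windows: "card windows = n choose m"
    unfolding windows_def by (simp add: n_subsets)
  have containing: "card {T \<in> windows. W c \<subseteq> T} = (n - w) choose (m - w)" if "c \<in> C" for c
    using card_supersets_within[of "{1..n}" "W c" m] W[OF that] \<open>w \<le> m\<close>
    unfolding windows_def is_witness_def by (simp add: conj_assoc)
  have contained: "card {c \<in> C. W c \<subseteq> T} \<le> 2 ^ m" if "T \<in> windows" for T
  proof -
    have "is_witness n C c T" if "c \<in> C" "W c \<subseteq> T" for c
      using is_witness_mono W(1) that \<open>T \<in> windows\<close> unfolding windows_def by blast
    then have "card {c \<in> C. W c \<subseteq> T} \<le> card {c \<in> C. is_witness n C c T}"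
      using fin by (intro card_mono) auto
    also have "\<dots> \<le> 2 ^ m"
      using card_common_witness_le[OF sub] that unfolding windows_def by blast
    finally show ?thesis .
  qed
  have "card C * ((n - w) choose (m - w)) = (\<Sum>T\<in>windows. card {c \<in> C. W c \<subseteq> T})"
    using sum_multicount[of windows C "\<lambda>T c. W c \<subseteq> T" "(n - w) choose (m - w)"]
      containing fin fin_windows by simp
  also have "\<dots> \<le> (\<Sum>T\<in>windows. 2 ^ m)"
    using contained by (rule sum_mono)
  also have "\<dots> = 2 ^ m * (n choose m)"
    by (simp add: card_windows)
  finally have count: "card C * ((n - w) choose (m - w)) \<le> 2 ^ m * (n choose m)" .
  \<comment> \<open>Subset-of-a-subset identity: trade the two counts of windows for \<open>m choose w\<close>
    and \<open>n choose w\<close>, and cancel \<open>(n - w) choose (m - w)\<close>.\<close>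
  have "((n - w) choose (m - w)) * (card C * (m choose w))
      = card C * ((n - w) choose (m - w)) * (m choose w)"
    by simp
  also have "\<dots> \<le> 2 ^ m * (n choose m) * (m choose w)"
    using count by (rule mult_right_mono) simp
  also have "\<dots> = ((n - w) choose (m - w)) * (2 ^ m * (n choose w))"
    using choose_mult[OF assms(2,3)] by (simp add: mult_ac)
  finally show ?thesis
    using assms by simp
qed

theorem theorem2:
  fixes n w :: nat
  assumes "1 \<le> w" and "real w \<le> real n / 2"
  shows "real (max_witness_code n w) \<le> 2 * sqrt (real w) * real (n choose w)"
proof -
  obtain C where code: "witness_code n w C" and card: "card C = max_witness_code n w"
    using max_witness_code_attained by blast
  define b where "b = (2 * w) choose w"
  have "b > 0"
    unfolding b_def by simp
  have "2 * w \<le> n"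
    using assms(2) by linarith
  then have "card C * b \<le> 2 ^ (2 * w) * (n choose w)"
    using witness_code_window_bound[OF code, of "2 * w"] unfolding b_def by simp
  then have "real (card C * b) \<le> real (2 ^ (2 * w) * (n choose w))"
    by (subst of_nat_le_iff)
  then have "real (card C) * real b \<le> 4 ^ w * real (n choose w)"
    by (simp add: power_mult)
  also have "\<dots> \<le> 2 * sqrt (real w) * real b * real (n choose w)"
    using power_4_le_central_binomial[OF assms(1)] unfolding b_def
    by (rule mult_right_mono) simp
  also have "\<dots> = 2 * sqrt (real w) * real (n choose w) * real b"
    by simp
  finally show ?thesis
    using \<open>b > 0\<close> card by simp
qed

end
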